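(* There is a sequence $Y\in 2^\omega$ with $\dim(Y)=1/2$ such that $\dim(X)>0$ for all $X\in 2^\omega$ with $d(X,Y)\le H^{-1}(1/2)$.
   Context: $2^\omega$ is the space of infinite binary sequences and $Z\upharpoonright_n$ is the $n$-bit prefix of $Z$. $K$ denotes prefix-free Kolmogorov complexity. The effective Hausdorff dimension of $X\in 2^\omega$ is $\dim(X)=\liminf_{n\to\infty} K(X\upharpoonright_n)/n$. For $n\ge 1$ and $\sigma,\tau\in\{0,1\}^n$, $d(\sigma,\tau)=\#\{k:\sigma(k)\ne\tau(k)\}/n$; for $X,Y\in 2^\omega$, $d(X,Y)=\limsup_{n\to\infty} d(X\upharpoonright_n,Y\upharpoonright_n)$. $H(p)=-(p\log_2 p+(1-p)\log_2(1-p))$ is the binary entropy function on $[0,1]$ (with $H(0)=H(1)=0$), and $H^{-1}:[0,1]\to[0,1/2]$ is the inverse of the restriction of $H$ to $[0,1/2]$. *)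

theory Defs
  imports
    Complex_Main
    "HOL-Library.Sublist"
    "HOL-Library.Liminf_Limsup"
    "HOL-Library.Extended_Real"
begin

section \<open>Partial recursive functions\<close>

text \<open>
  Kleene's class of partial recursive functions.  In \<open>partial_recursive n f\<close> the number \<open>n\<close> is the
  arity, and \<open>f\<close> is only meaningful on argument lists of length \<open>n\<close>; its values on lists of
  any other length are irrelevant.
\<close>

inductive partial_recursive :: "nat \<Rightarrow> (nat list \<Rightarrow> nat option) \<Rightarrow> bool" where
  zero: "partial_recursive n (\<lambda>xs. Some 0)"
| succ: "partial_recursive 1 (\<lambda>xs. Some (Suc (hd xs)))"
| proj: "i < n \<Longrightarrow> partial_recursive n (\<lambda>xs. Some (xs ! i))"
| comp: "partial_recursive (length gs) f \<Longrightarrow> (\<forall>g \<in> set gs. partial_recursive n g) \<Longrightarrow>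
    partial_recursive n
      (\<lambda>xs. if \<forall>g \<in> set gs. g xs \<noteq> None then f (map (\<lambda>g. the (g xs)) gs) else None)"
| prim_rec: "partial_recursive n f \<Longrightarrow> partial_recursive (Suc (Suc n)) g \<Longrightarrow>
    partial_recursive (Suc n)
      (\<lambda>xs. rec_nat (f (tl xs)) (\<lambda>k r. Option.bind r (\<lambda>y. g (k # y # tl xs))) (hd xs))"
| minim: "partial_recursive (Suc n) f \<Longrightarrow>
    partial_recursive n
      (\<lambda>xs. if \<exists>k. f (k # xs) = Some 0 \<and> (\<forall>j<k. f (j # xs) \<noteq> None)
            then Some (LEAST k. f (k # xs) = Some 0) else None)"

section \<open>Prefix-free machines and Kolmogorov complexity\<close>

text \<open>Bijective base-2 numeration, with the head of the list as the least significant digit.\<close>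

fun str_code :: "bool list \<Rightarrow> nat" where
  "str_code [] = 0"
| "str_code (b # bs) = 2 * str_code bs + (if b then 2 else 1)"

lemma inj_str_code: "inj str_code"
proof (rule injI)
  fix s t :: "bool list"
  assume "str_code s = str_code t"
  then show "s = t"
  proof (induction s arbitrary: t)
    case Nil
    then show ?case by (cases t) (auto split: if_splits)
  next
    case (Cons b s)
    then obtain c t' where t: "t = c # t'"
      by (cases t) (auto split: if_splits)
    from Cons.prems have "b = c \<and> str_code s = str_code t'"
      unfolding t by (cases b; cases c; simp; presburger)
    with Cons.IH t show ?case by simp
  qed
qed

lemma surj_str_code: "surj str_code"
proof -
  have "\<exists>s. str_code s = n" for n
  proof (induction n rule: less_induct)
    case (less n)
    show ?case
    proof (cases "n = 0")
      case True
      then show ?thesis by (metis str_code.simps(1))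
    next
      case False
      then have "(n - 1) div 2 < n" by simp
      with less obtain s where s: "str_code s = (n - 1) div 2" by blast
      have "str_code (even n # s) = n"
        using False s by (simp; presburger)
      then show ?thesis ..
    qed
  qed
  then show ?thesis by (metis surjI)
qed

type_synonym machine = "bool list \<Rightarrow> bool list option"

definition partial_computable :: "machine \<Rightarrow> bool" where
  "partial_computable M \<longleftrightarrow>
     (\<exists>f. partial_recursive 1 f \<and> (\<forall>s. f [str_code s] = map_option str_code (M s)))"

definition prefix_free_machine :: "machine \<Rightarrow> bool" where
  "prefix_free_machine M \<longleftrightarrow>
     partial_computable M \<and> (\<forall>s \<in> dom M. \<forall>t \<in> dom M. prefix s t \<longrightarrow> s = t)"

text \<open>
  \<open>U\<close> simulates every prefix-free machine with at most a constant increase of program length.  Such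
  machines exist, and any two of them have complexities that differ by a bounded amount, so that
  the effective dimension below does not depend on the choice of \<open>U\<close>.
\<close>

definition universal_prefix_free_machine :: "machine \<Rightarrow> bool" where
  "universal_prefix_free_machine U \<longleftrightarrow>
     prefix_free_machine U \<and>
     (\<forall>M. prefix_free_machine M \<longrightarrow>
        (\<exists>c. \<forall>p s. M p = Some s \<longrightarrow> (\<exists>q. U q = Some s \<and> length q \<le> length p + c)))"

text \<open>For universal \<open>U\<close> every string has a program, so the minimum is always attained.\<close>

definition prefix_complexity :: "machine \<Rightarrow> bool list \<Rightarrow> nat" where
  "prefix_complexity U s = (LEAST n. \<exists>p. U p = Some s \<and> length p = n)"

section \<open>Effective Hausdorff dimension and distance\<close>

definition seq_prefix :: "(nat \<Rightarrow> bool) \<Rightarrow> nat \<Rightarrow> bool list" where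
  "seq_prefix Z n = map Z [0..<n]"

definition effective_dim :: "machine \<Rightarrow> (nat \<Rightarrow> bool) \<Rightarrow> ereal" where
  "effective_dim U X = liminf (\<lambda>n. ereal (real (prefix_complexity U (seq_prefix X n)) / real n))"

definition hamming_dist :: "bool list \<Rightarrow> bool list \<Rightarrow> real" where
  "hamming_dist s t = real (card {k. k < length s \<and> s ! k \<noteq> t ! k}) / real (length s)"

definition seq_dist :: "(nat \<Rightarrow> bool) \<Rightarrow> (nat \<Rightarrow> bool) \<Rightarrow> ereal" where
  "seq_dist X Y = limsup (\<lambda>n. ereal (hamming_dist (seq_prefix X n) (seq_prefix Y n)))"

section \<open>Binary entropy\<close>

text \<open>The values at 0 and 1 come out as 0, because the logarithm is multiplied by 0 there.\<close>

definition binary_entropy :: "real \<Rightarrow> real" where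
  "binary_entropy p = - (p * log 2 p + (1 - p) * log 2 (1 - p))"

definition binary_entropy_inv :: "real \<Rightarrow> real" where
  "binary_entropy_inv = the_inv_into {0..1/2} binary_entropy"

end

theory Submission
  imports Defs "HOL-Analysis.Complex_Transcendental"
begin

text \<open>
  The sequence \<open>Y\<close> carries free bits at the even positions and \<open>False\<close> at the odd ones, so that
  a prefix of length \<open>n\<close> contains \<open>n/2\<close> free bits.

  For typical free bits, \<open>dim Y \<ge> 1/2\<close> because there are too few short programs to describe most of
  the \<open>2 ^ (n/2)\<close> possible prefixes.  On the other hand \<open>Y\<close> restricted to \<open>2 * k\<^sup>2\<close> bits is
  the output of a prefix-free machine on \<open>1 ^ k 0 q\<close>, where \<open>q\<close> consists of the \<open>k\<^sup>2\<close> free bits: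
  this program has length \<open>k\<^sup>2 + O(k)\<close>, and hence \<open>dim Y \<le> 1/2\<close>.

  Now let \<open>X\<close> be close to \<open>Y\<close>, where \<open>H\<inverse>(1/2) < 1/8\<close>.  Mismatches between a prefix \<open>x\<close> of \<open>X\<close> of
  length \<open>n\<close> and the prefix of \<open>Y\<close> number at most \<open>n/8\<close>, and even if they all fall on the \<open>n/2\<close> free
  positions, they are a proportion of at most \<open>1/4\<close> of these.  A Hamming ball of relative radius
  \<open>1/4 < 1/2\<close> around \<open>x\<close> contains an exponentially small fraction of all choices of the free bits.
  There are at most \<open>2 ^ (n/16 + 1)\<close> strings \<open>x\<close> of complexity at most \<open>n/16\<close>, so even the union of
  the balls around all of them is exponentially small.  Typical free bits therefore avoid this
  union for all large \<open>n\<close>, which means that every prefix of \<open>X\<close> of large length \<open>n\<close> has complexity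
  above \<open>n/16\<close>.

  Both properties asked of the free bits have the form ``avoid, for each \<open>n \<ge> n0\<close>, a set of
  prefixes of length \<open>n\<close> whose probabilities form a convergent series'', so the first
  Borel--Cantelli argument, in the combinatorial form \<open>exists_sequence_avoiding\<close>, supplies them
  (\<open>exists_incompressible_isolated\<close>).  Computability enters only through the machine for the upper
  bound and through the fact that a universal machine has some program for each string.
\<close>

section \<open>Total recursive functions\<close>

definition total_recursive :: "nat \<Rightarrow> (nat list \<Rightarrow> nat) \<Rightarrow> bool" where
  "total_recursive n F \<longleftrightarrow> (\<exists>f. partial_recursive n f \<and> (\<forall>xs. length xs = n \<longrightarrow> f xs = Some (F xs)))"

lemma total_recursive_cong:
  assumes "total_recursive n F" "\<And>xs. length xs = n \<Longrightarrow> F xs = G xs"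
  shows "total_recursive n G"
  using assms unfolding total_recursive_def by auto

lemma total_recursive_proj: "i < n \<Longrightarrow> total_recursive n (\<lambda>xs. xs ! i)"
  unfolding total_recursive_def by (blast intro: partial_recursive.proj)

lemma total_recursive_comp:
  assumes "total_recursive (length Gs) F" "\<And>G. G \<in> set Gs \<Longrightarrow> total_recursive n G"
  shows "total_recursive n (\<lambda>xs. F (map (\<lambda>G. G xs) Gs))"
proof -
  obtain f where f: "partial_recursive (length Gs) f"
    "\<And>xs. length xs = length Gs \<Longrightarrow> f xs = Some (F xs)"
    using assms(1) unfolding total_recursive_def by blast
  have "\<forall>G\<in>set Gs. \<exists>g. partial_recursive n g \<and> (\<forall>xs. length xs = n \<longrightarrow> g xs = Some (G xs))"
    using assms(2) unfolding total_recursive_def by blast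
  then obtain h where h: "\<And>G. G \<in> set Gs \<Longrightarrow> partial_recursive n (h G)"
    "\<And>G xs. G \<in> set Gs \<Longrightarrow> length xs = n \<Longrightarrow> h G xs = Some (G xs)"
    by metis
  have "partial_recursive n (\<lambda>xs. if \<forall>g \<in> set (map h Gs). g xs \<noteq> None
      then f (map (\<lambda>g. the (g xs)) (map h Gs)) else None)"
    by (rule partial_recursive.comp) (use f h in auto)
  moreover have "(if \<forall>g \<in> set (map h Gs). g xs \<noteq> None
      then f (map (\<lambda>g. the (g xs)) (map h Gs)) else None) = Some (F (map (\<lambda>G. G xs) Gs))"
    if "length xs = n" for xs
  proof -
    have "map (\<lambda>g. the (g xs)) (map h Gs) = map (\<lambda>G. G xs) Gs"
      using h(2) that by auto
    moreover have "\<forall>g \<in> set (map h Gs). g xs \<noteq> None"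
      using h(2) that by auto
    ultimately show ?thesis using f(2)[of "map (\<lambda>G. G xs) Gs"] by (simp del: map_map)
  qed
  ultimately show ?thesis unfolding total_recursive_def by blast
qed

lemma total_recursive_Cons:
  assumes "total_recursive (Suc n) F" "total_recursive n N"
  shows "total_recursive n (\<lambda>xs. F (N xs # xs))"
proof (rule total_recursive_cong)
  show "total_recursive n (\<lambda>xs. F (map (\<lambda>G. G xs) (N # map (\<lambda>i xs. xs ! i) [0..<n])))"
    by (rule total_recursive_comp) (use assms in \<open>auto intro: total_recursive_proj\<close>)
  show "F (map (\<lambda>G. G xs) (N # map (\<lambda>i xs. xs ! i) [0..<n])) = F (N xs # xs)"
    if "length xs = n" for xs
    using that by (auto simp: comp_def map_nth)
qed

lemma map_nth_shift: "length xs = m + n \<Longrightarrow> map (\<lambda>i. xs ! (m + i)) [0..<n] = drop m xs"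
  by (auto intro: nth_equalityI)

lemma total_recursive_drop:
  assumes "total_recursive n F"
  shows "total_recursive (m + n) (\<lambda>xs. F (drop m xs))"
proof (rule total_recursive_cong)
  show "total_recursive (m + n) (\<lambda>xs. F (map (\<lambda>G. G xs) (map (\<lambda>i xs. xs ! (m + i)) [0..<n])))"
    by (rule total_recursive_comp) (use assms in \<open>auto intro: total_recursive_proj\<close>)
  show "F (map (\<lambda>G. G xs) (map (\<lambda>i xs. xs ! (m + i)) [0..<n])) = F (drop m xs)"
    if "length xs = m + n" for xs
    using that by (auto simp: comp_def map_nth_shift)
qed

lemma total_recursive_Suc:
  assumes "total_recursive n F"
  shows "total_recursive n (\<lambda>xs. Suc (F xs))"
proof -
  have "total_recursive (length [F]) (\<lambda>xs. Suc (hd xs))"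
    unfolding total_recursive_def using partial_recursive.succ by auto
  from total_recursive_comp[OF this, of n] show ?thesis using assms by auto
qed

lemma total_recursive_const: "total_recursive n (\<lambda>xs. c)"
proof (induction c)
  case 0
  then show ?case unfolding total_recursive_def by (blast intro: partial_recursive.zero)
qed (rule total_recursive_Suc)

text \<open>
  The parameters \<open>xs\<close> and the recursion bound \<open>N xs\<close> are separate here, unlike in Kleene's schema,
  where the bound is itself the first argument; this is the form in which arithmetic functions of
  given recursive functions are obtained.
\<close>
lemma total_recursive_rec:
  assumes F: "total_recursive n F" and G: "total_recursive (Suc (Suc n)) G"
    and N: "total_recursive n N"
  shows "total_recursive n (\<lambda>xs. rec_nat (F xs) (\<lambda>k r. G (k # r # xs)) (N xs))"
proof -
  obtain f g where f: "partial_recursive n f" "\<And>xs. length xs = n \<Longrightarrow> f xs = Some (F xs)"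
    and g: "partial_recursive (Suc (Suc n)) g" "\<And>xs. length xs = Suc (Suc n) \<Longrightarrow> g xs = Some (G xs)"
    using F G unfolding total_recursive_def by blast
  have eq: "rec_nat (f xs) (\<lambda>k r. Option.bind r (\<lambda>y. g (k # y # xs))) m =
      Some (rec_nat (F xs) (\<lambda>k r. G (k # r # xs)) m)" if "length xs = n" for xs m
    using that by (induction m) (auto simp: f g)
  have "total_recursive (Suc n) (\<lambda>xs. rec_nat (F (tl xs)) (\<lambda>k r. G (k # r # tl xs)) (hd xs))"
    unfolding total_recursive_def
    by (rule exI, rule conjI, rule partial_recursive.prim_rec[OF f(1) g(1)]) (simp add: eq)
  from total_recursive_Cons[OF this N] show ?thesis by simp
qed

lemma total_recursive_add:
  assumes "total_recursive n F" "total_recursive n G"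
  shows "total_recursive n (\<lambda>xs. F xs + G xs)"
proof -
  have "total_recursive n (\<lambda>xs. rec_nat (F xs) (\<lambda>k r. Suc ((k # r # xs) ! 1)) (G xs))"
    by (intro total_recursive_rec total_recursive_Suc total_recursive_proj assms) simp
  moreover have "rec_nat a (\<lambda>k r. Suc ((k # r # xs) ! 1)) b = a + b" for a b and xs :: "nat list"
    by (induction b) auto
  ultimately show ?thesis by simp
qed

lemma total_recursive_sum:
  assumes "total_recursive (Suc n) F" "total_recursive n N"
  shows "total_recursive n (\<lambda>xs. \<Sum>i<N xs. F (i # xs))"
proof -
  have "total_recursive (Suc (Suc n)) (\<lambda>ys. F (map (\<lambda>G. G ys) ((\<lambda>ys. ys ! 0) # map (\<lambda>i ys. ys ! (2 + i)) [0..<n])))"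
    by (rule total_recursive_comp) (use assms in \<open>auto intro!: total_recursive_proj\<close>)
  then have "total_recursive (Suc (Suc n)) (\<lambda>ys. F (ys ! 0 # drop 2 ys))"
    by (rule total_recursive_cong) (auto simp: comp_def map_nth_shift[of _ 2 n, simplified])
  then have "total_recursive (Suc (Suc n)) (\<lambda>ys. ys ! 1 + F (ys ! 0 # drop 2 ys))"
    by (intro total_recursive_add total_recursive_proj) auto
  from total_recursive_rec[OF total_recursive_const[of n 0] this assms(2)]
  have "total_recursive n (\<lambda>xs. rec_nat 0 (\<lambda>k r. r + F (k # xs)) (N xs))" by simp
  moreover have "rec_nat 0 (\<lambda>k r. r + F (k # xs)) m = (\<Sum>i<m. F (i # xs))" for xs m
    by (induction m) auto
  ultimately show ?thesis by simp
qed

lemma total_recursive_mult: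
  assumes "total_recursive n F" "total_recursive n G"
  shows "total_recursive n (\<lambda>xs. F xs * G xs)"
proof -
  have "total_recursive (Suc n) (\<lambda>ys. F (drop 1 ys))"
    using total_recursive_drop[OF assms(1), of 1] by simp
  from total_recursive_sum[OF this assms(2)] show ?thesis by (simp add: mult.commute)
qed

lemma total_recursive_power:
  assumes "total_recursive n F" "total_recursive n G"
  shows "total_recursive n (\<lambda>xs. F xs ^ G xs)"
proof -
  have "total_recursive (Suc (Suc n)) (\<lambda>ys. ys ! 1 * F (drop 2 ys))"
    using total_recursive_drop[OF assms(1), of 2]
    by (intro total_recursive_mult total_recursive_proj) auto
  from total_recursive_rec[OF total_recursive_const[of n 1] this assms(2)]
  have "total_recursive n (\<lambda>xs. rec_nat 1 (\<lambda>k r. r * F xs) (G xs))" by simp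
  moreover have "rec_nat 1 (\<lambda>k r. r * a) m = a ^ m" for a m :: nat
    by (induction m) auto
  ultimately show ?thesis by simp
qed

lemma total_recursive_diff:
  assumes "total_recursive n F" "total_recursive n G"
  shows "total_recursive n (\<lambda>xs. F xs - G xs)"
proof -
  have pred: "total_recursive m (\<lambda>xs. H xs - 1)" if "total_recursive m H" for m H
  proof -
    have "total_recursive m (\<lambda>xs. rec_nat 0 (\<lambda>k r. (k # r # xs) ! 0) (H xs))"
      by (intro total_recursive_rec total_recursive_const total_recursive_proj that) simp
    moreover have "rec_nat 0 (\<lambda>k r. (k # r # xs) ! 0) b = b - 1" for b and xs :: "nat list"
      by (cases b) auto
    ultimately show ?thesis by simp
  qed
  have "total_recursive n (\<lambda>xs. rec_nat (F xs) (\<lambda>k r. (k # r # xs) ! 1 - 1) (G xs))"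
    by (intro total_recursive_rec pred total_recursive_proj assms) simp
  moreover have "rec_nat a (\<lambda>k r. (k # r # xs) ! 1 - 1) b = a - b" for a b and xs :: "nat list"
    by (induction b) auto
  ultimately show ?thesis by simp
qed

lemma total_recursive_Least:
  assumes F: "total_recursive (Suc n) F" and ex: "\<And>xs. length xs = n \<Longrightarrow> \<exists>k. F (k # xs) = 0"
  shows "total_recursive n (\<lambda>xs. LEAST k. F (k # xs) = 0)"
proof -
  obtain f where f: "partial_recursive (Suc n) f" "\<And>xs. length xs = Suc n \<Longrightarrow> f xs = Some (F xs)"
    using F unfolding total_recursive_def by blast
  show ?thesis
    unfolding total_recursive_def
    by (rule exI, rule conjI, rule partial_recursive.minim[OF f(1)]) (auto simp: f(2) ex)
qed

text \<open>
  Division is an unbounded search for the first \<open>q\<close> with \<open>F xs < (q + 1) * 2 ^ G xs\<close>.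
\<close>
lemma total_recursive_div_power2:
  assumes "total_recursive n F" "total_recursive n G"
  shows "total_recursive n (\<lambda>xs. F xs div 2 ^ G xs)"
proof (rule total_recursive_cong)
  let ?T = "\<lambda>xs. Suc (F (drop 1 xs)) - Suc (xs ! 0) * 2 ^ G (drop 1 xs)"
  have "total_recursive (Suc n) ?T"
    using total_recursive_drop[OF assms(1), of 1] total_recursive_drop[OF assms(2), of 1]
    by (intro total_recursive_diff total_recursive_Suc total_recursive_mult total_recursive_power
        total_recursive_const total_recursive_proj) auto
  moreover have "\<exists>k. ?T (k # xs) = 0" for xs
    using add_mono[of 1 "2 ^ G xs" "F xs" "F xs * 2 ^ G xs"] by (intro exI[of _ "F xs"]) simp
  ultimately show "total_recursive n (\<lambda>xs. LEAST k. ?T (k # xs) = 0)"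
    by (rule total_recursive_Least)
  show "(LEAST k. ?T (k # xs) = 0) = F xs div 2 ^ G xs" for xs
  proof (rule Least_equality)
    have "F xs < Suc (F xs div 2 ^ G xs) * 2 ^ G xs"
      by (metis dividend_less_div_times mult_Suc zero_less_numeral zero_less_power add.commute)
    then show "?T ((F xs div 2 ^ G xs) # xs) = 0" by simp
    fix k assume "?T (k # xs) = 0"
    then have "F xs < Suc k * 2 ^ G xs" by simp
    then have "F xs div 2 ^ G xs < Suc k"
      by (simp only: less_mult_imp_div_less)
    then show "F xs div 2 ^ G xs \<le> k" by simp
  qed
qed

lemma total_recursive_mod2:
  assumes "total_recursive n F"
  shows "total_recursive n (\<lambda>xs. F xs mod 2)"
proof (rule total_recursive_cong)
  show "total_recursive n (\<lambda>xs. F xs - 2 * (F xs div 2 ^ 1))"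
    by (intro total_recursive_diff total_recursive_mult total_recursive_const
        total_recursive_div_power2 assms)
qed (simp add: minus_mult_div_eq_mod)

text \<open>
  All partiality that the machines need comes from a decidable test of their input.  The test is
  turned into divergence by minimising a function that ignores the search variable: the search
  succeeds at once or never.
\<close>
lemma partial_recursive_restrict:
  assumes C: "total_recursive n C" and G: "total_recursive n G"
  shows "\<exists>f. partial_recursive n f \<and>
    (\<forall>xs. length xs = n \<longrightarrow> f xs = (if C xs = 0 then Some (G xs) else None))"
proof -
  have "total_recursive (Suc n) (\<lambda>xs. C (drop 1 xs))"
    using total_recursive_drop[OF C, of 1] by simp
  then obtain c where c: "partial_recursive (Suc n) c"
    "\<And>xs. length xs = Suc n \<Longrightarrow> c xs = Some (C (drop 1 xs))"
    unfolding total_recursive_def by blast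
  obtain g where g: "partial_recursive n g" "\<And>xs. length xs = n \<Longrightarrow> g xs = Some (G xs)"
    using G unfolding total_recursive_def by blast
  have "total_recursive 2 (\<lambda>xs. xs ! 1)" by (rule total_recursive_proj) simp
  then obtain s where s: "partial_recursive 2 s" "\<And>xs. length xs = 2 \<Longrightarrow> s xs = Some (xs ! 1)"
    unfolding total_recursive_def by blast
  let ?m = "\<lambda>xs. if \<exists>k. c (k # xs) = Some 0 \<and> (\<forall>j<k. c (j # xs) \<noteq> None)
            then Some (LEAST k. c (k # xs) = Some 0) else None"
  have m: "(?m xs \<noteq> None) = (C xs = 0)" if "length xs = n" for xs
    using that by (auto simp: c(2))
  have "partial_recursive n (\<lambda>xs. if \<forall>g \<in> set [?m, g]. g xs \<noteq> None
      then s (map (\<lambda>g. the (g xs)) [?m, g]) else None)"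
    using partial_recursive.minim[OF c(1)] s g by (intro partial_recursive.comp) (auto simp: numeral_2_eq_2)
  moreover have "(if \<forall>g \<in> set [?m, g]. g xs \<noteq> None
      then s (map (\<lambda>g. the (g xs)) [?m, g]) else None) = (if C xs = 0 then Some (G xs) else None)"
    if "length xs = n" for xs
  proof -
    have "(\<forall>g \<in> set [?m, g]. g xs \<noteq> None) = (C xs = 0)"
      using m[OF that] g(2)[OF that] by (simp del: not_None_eq)
    moreover have "s (map (\<lambda>g. the (g xs)) [?m, g]) = Some (G xs)"
      by (subst s(2)) (simp_all add: g(2)[OF that])
    ultimately show ?thesis by presburger
  qed
  ultimately show ?thesis by blast
qed

section \<open>A prefix-free machine that inserts zeros\<close>

text \<open>
  Bijective numeration becomes ordinary binary after adding one: \<open>Suc (str_code p)\<close> has the digits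
  of \<open>p\<close> below a leading one at position \<open>length p\<close>.  Thus arithmetic on codes can read off single
  bits, and the length of \<open>p\<close> is the unique \<open>L\<close> for which the quotient by \<open>2 ^ L\<close> is one.
\<close>
lemma str_code_div_power2:
  "Suc (str_code p) div 2 ^ i = (if i \<le> length p then Suc (str_code (drop i p)) else 0)"
proof (induction p arbitrary: i)
  case Nil
  have "Suc 0 div 2 ^ i = 0" if "i > 0" for i :: nat
    using that one_less_power[of "2::nat" i] by (intro div_less) simp
  then show ?case by simp
next
  case (Cons b p)
  show ?case
  proof (cases i)
    case (Suc j)
    have "Suc (str_code (b # p)) div 2 = Suc (str_code p)" by auto
    then have "Suc (str_code (b # p)) div 2 ^ i = Suc (str_code p) div 2 ^ j"
      unfolding Suc by (metis div_mult2_eq power_Suc)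
    then show ?thesis using Cons.IH[of j] Suc by simp
  qed simp
qed

lemma str_code_digit:
  assumes "i < length p"
  shows "Suc (str_code p) div 2 ^ i mod 2 = of_bool (p ! i)"
proof -
  have "drop i p = p ! i # drop (Suc i) p" using assms by (simp add: Cons_nth_drop_Suc)
  then have "Suc (str_code p) div 2 ^ i = Suc (2 * str_code (drop (Suc i) p) + (if p ! i then 2 else 1))"
    using assms by (simp add: str_code_div_power2)
  also have "\<dots> mod 2 = of_bool (p ! i)" by (cases "p ! i") (simp_all add: mod_Suc)
  finally show ?thesis .
qed

definition pad :: "bool list \<Rightarrow> bool list" where
  "pad q = concat (map (\<lambda>b. [b, False]) q)"

text \<open>
  A bit \<open>b\<close> and the inserted zero together contribute the digits \<open>1 + b\<close> and \<open>1\<close>, that is,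
  \<open>(1 + b) + 2 * 1\<close>, to the code.  The output of the machine below is thus an arithmetic sum.
\<close>
lemma str_code_pad: "str_code (pad q) = (\<Sum>i<length q. 4 ^ i * (3 + of_bool (q ! i)))"
proof (induction q)
  case (Cons b q)
  have "(\<Sum>i<length (b # q). 4 ^ i * (3 + of_bool ((b # q) ! i))) =
     3 + of_bool b + 4 * (\<Sum>i<length q. 4 ^ i * (3 + of_bool (q ! i)) :: nat)"
    by (simp add: sum.lessThan_Suc_shift sum_distrib_left mult.assoc del: sum.lessThan_Suc)
  then show ?case using Cons by (simp add: pad_def)
qed (simp add: pad_def)

definition leading_ones :: "bool list \<Rightarrow> nat" where
  "leading_ones p = length (takeWhile id p)"

text \<open>
  The header \<open>1 ^ k 0\<close> announces a block of exactly \<open>k * k\<close> bits, which makes the domain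
  prefix-free.  Since it costs only about the square root of the length of the block, it does not
  affect the ratio of program length to output length in the limit.
\<close>
definition pad_machine :: machine where
  "pad_machine p = (let k = leading_ones p in
     if length p = Suc k + k * k then Some (pad (drop (Suc k) p)) else None)"

lemma leading_ones_eq_Least:
  assumes "leading_ones p < length p"
  shows "(LEAST k. Suc (str_code p) div 2 ^ k mod 2 = 0) = leading_ones p"
proof (rule Least_equality)
  show "Suc (str_code p) div 2 ^ leading_ones p mod 2 = 0"
    using nth_length_takeWhile[of id p] assms by (subst str_code_digit) (auto simp: leading_ones_def)
  fix k assume k: "Suc (str_code p) div 2 ^ k mod 2 = 0"
  show "leading_ones p \<le> k"
  proof (rule ccontr)
    assume "\<not> leading_ones p \<le> k"
    then have "k < leading_ones p" by simp
    then have "p ! k"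
      unfolding leading_ones_def by (metis id_apply nth_mem set_takeWhileD takeWhile_nth)
    then show False using k \<open>k < leading_ones p\<close> assms str_code_digit[of k p] by simp
  qed
qed

text \<open>
  If \<open>p\<close> has no zero, the search for the end of the header runs over the leading one of
  \<open>Suc (str_code p)\<close> and stops just after it.  The length announced by this value is too large for
  \<open>p\<close>, so that the arithmetic version of the machine rejects \<open>p\<close>, as it should.
\<close>
lemma leading_ones_eq_Least_None:
  assumes "\<not> leading_ones p < length p"
  shows "(LEAST k. Suc (str_code p) div 2 ^ k mod 2 = 0) = Suc (length p)"
proof (rule Least_equality)
  show "Suc (str_code p) div 2 ^ Suc (length p) mod 2 = 0"
    by (subst str_code_div_power2) simp
  have "takeWhile id p = p"
    using assms takeWhile_eq_take[of id p] by (simp add: leading_ones_def)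
  then have all: "\<forall>b\<in>set p. b" by (metis id_apply set_takeWhileD)
  fix k assume k: "Suc (str_code p) div 2 ^ k mod 2 = 0"
  show "Suc (length p) \<le> k"
  proof (rule ccontr)
    assume "\<not> Suc (length p) \<le> k"
    then consider "k < length p" | "k = length p" by linarith
    then show False
    proof cases
      case 1
      then have "p ! k" using all nth_mem by blast
      then show False using k str_code_digit[OF 1] by simp
    next
      case 2
      then show False using k str_code_div_power2[of p k] by simp
    qed
  qed
qed

text \<open>
  On codes, \<open>k\<close> below finds the end of the header, \<open>d\<close> is one exactly if the program has the
  announced length, and \<open>g\<close> assembles the code of the output from the bits of the block.
\<close>
lemma partial_computable_pad_machine: "partial_computable pad_machine"
proof -
  define k where "k xs = (LEAST k. (Suc (xs ! 0)) div 2 ^ k mod 2 = 0)" for xs :: "nat list"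
  define d where "d xs = Suc (xs ! 0) div 2 ^ (Suc (k xs) + k xs * k xs)" for xs :: "nat list"
  define g where "g xs = (\<Sum>i<k xs * k xs.
    4 ^ i * (3 + Suc (xs ! 0) div 2 ^ (Suc (k xs) + i) mod 2))" for xs :: "nat list"
  note intros = total_recursive_add total_recursive_mult total_recursive_power total_recursive_diff
    total_recursive_const total_recursive_Suc total_recursive_mod2 total_recursive_div_power2
  have p0: "total_recursive 1 (\<lambda>xs. xs ! 0)" by (rule total_recursive_proj) simp
  have k: "total_recursive 1 k"
  proof (rule total_recursive_cong)
    let ?T = "\<lambda>ys. Suc (ys ! 1) div 2 ^ (ys ! 0) mod 2"
    have "total_recursive (Suc 1) ?T"
      by (intro intros total_recursive_proj) auto
    moreover have "\<exists>k. ?T (k # xs) = 0" for xs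
    proof
      show "?T (Suc (xs ! 0) # xs) = 0"
        using div_less[OF less_exp[of "Suc (xs ! 0)"]] by (simp only: nth_Cons_0 nth_Cons_Suc One_nat_def mod_0)
    qed
    ultimately show "total_recursive 1 (\<lambda>xs. LEAST k. ?T (k # xs) = 0)"
      by (rule total_recursive_Least)
  qed (simp add: k_def)
  have d: "total_recursive 1 d"
    unfolding d_def by (intro intros p0 k)
  have g: "total_recursive 1 g"
  proof (rule total_recursive_cong)
    have k': "total_recursive (Suc 1) (\<lambda>ys. k (drop 1 ys))"
      using total_recursive_drop[OF k, of 1] by simp
    have "total_recursive (Suc 1) (\<lambda>ys. 4 ^ (ys ! 0) *
        (3 + Suc (ys ! 1) div 2 ^ (Suc (k (drop 1 ys)) + ys ! 0) mod 2))"
      by (intro intros total_recursive_proj k') auto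
    then show "total_recursive 1 (\<lambda>xs. \<Sum>i<k xs * k xs. 4 ^ ((i # xs) ! 0) *
        (3 + Suc ((i # xs) ! 1) div 2 ^ (Suc (k (drop 1 (i # xs))) + (i # xs) ! 0) mod 2))"
      by (rule total_recursive_sum) (intro intros k)
  qed (simp add: g_def)
  have "total_recursive 1 (\<lambda>xs. (d xs - 1) + (1 - d xs))"
    by (intro intros d)
  from partial_recursive_restrict[OF this g] obtain f where
    f: "partial_recursive 1 f"
       "\<And>xs. length xs = 1 \<Longrightarrow> f xs = (if (d xs - 1) + (1 - d xs) = 0 then Some (g xs) else None)"
    by blast
  have "f [str_code p] = map_option str_code (pad_machine p)" for p
  proof -
    let ?xs = "[str_code p]"
    have 1: "f ?xs = (if d ?xs = 1 then Some (g ?xs) else None)"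
      by (subst f(2)) auto
    have d1: "d ?xs = 1 \<longleftrightarrow> length p = Suc (k ?xs) + k ?xs * k ?xs"
    proof -
      have "str_code s = 0 \<longleftrightarrow> s = []" for s by (cases s) auto
      then show ?thesis
        unfolding d_def using str_code_div_power2[of p "Suc (k ?xs) + k ?xs * k ?xs"] by simp
    qed
    show ?thesis
    proof (cases "leading_ones p < length p")
      case True
      have k: "k ?xs = leading_ones p" using leading_ones_eq_Least[OF True] by (simp add: k_def)
      have "g ?xs = str_code (pad (drop (Suc (leading_ones p)) p))" if "length p = Suc (leading_ones p) + leading_ones p * leading_ones p"
        unfolding str_code_pad g_def k
      proof (rule sum.cong)
        fix i assume i: "i \<in> {..<length (drop (Suc (leading_ones p)) p)}"
        then have "Suc (str_code p) div 2 ^ (Suc (leading_ones p) + i) mod 2 = of_bool (drop (Suc (leading_ones p)) p ! i)"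
          by (subst str_code_digit) auto
        then show "4 ^ i * (3 + Suc (?xs ! 0) div 2 ^ (Suc (leading_ones p) + i) mod 2) =
           4 ^ i * (3 + of_bool (drop (Suc (leading_ones p)) p ! i))" by simp
      qed (use that in simp)
      then show ?thesis unfolding 1 d1 k by (simp add: pad_machine_def Let_def)
    next
      case False
      have "k ?xs = Suc (length p)" using leading_ones_eq_Least_None[OF False] by (simp add: k_def)
      then show ?thesis unfolding 1 d1 using False by (simp add: pad_machine_def Let_def)
    qed
  qed
  then show ?thesis unfolding partial_computable_def using f(1) by blast
qed

lemma leading_ones_append: "leading_ones p < length p \<Longrightarrow> leading_ones (p @ r) = leading_ones p"
proof -
  assume "leading_ones p < length p"
  then have "takeWhile id p \<noteq> p" unfolding leading_ones_def by (metis less_irrefl)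
  then obtain b where "b \<in> set p" "\<not> id b" unfolding takeWhile_eq_all_conv by blast
  then have "takeWhile id (p @ r) = takeWhile id p" by (rule takeWhile_append1)
  then show ?thesis by (simp only: leading_ones_def)
qed

lemma prefix_free_pad_machine: "prefix_free_machine pad_machine"
  unfolding prefix_free_machine_def
proof (intro conjI partial_computable_pad_machine ballI impI)
  fix s t assume "s \<in> dom pad_machine" "t \<in> dom pad_machine" "prefix s t"
  then have s: "length s = Suc (leading_ones s) + leading_ones s * leading_ones s" and t: "length t = Suc (leading_ones t) + leading_ones t * leading_ones t"
    by (auto simp: pad_machine_def Let_def split: if_splits)
  obtain r where r: "t = s @ r" using \<open>prefix s t\<close> by (auto simp: prefix_def)
  have "leading_ones t = leading_ones s" unfolding r using s by (intro leading_ones_append) simp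
  then show "s = t" using s t r by simp
qed

lemma pad_machine_program:
  assumes "length q = k * k"
  shows "pad_machine (replicate k True @ False # q) = Some (pad q)"
proof -
  have "leading_ones (replicate k True @ False # q) = k"
    by (induction k) (auto simp: leading_ones_def)
  then show ?thesis using assms by (simp add: pad_machine_def)
qed


section \<open>Counting strings of low complexity\<close>

text \<open>
  These trivial machines guarantee that a universal machine outputs every string, so that
  \<open>prefix_complexity\<close> is the length of an actual program.
\<close>
lemma prefix_free_constant: "prefix_free_machine (\<lambda>p. if p = [] then Some s else None)"
proof -
  have "\<exists>f. partial_recursive 1 f \<and>
    (\<forall>xs. length xs = 1 \<longrightarrow> f xs = (if xs ! 0 = 0 then Some (str_code s) else None))"
    by (rule partial_recursive_restrict[OF total_recursive_proj total_recursive_const]) simp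
  then obtain f where f: "partial_recursive 1 f"
    "\<And>xs. length xs = 1 \<Longrightarrow> f xs = (if xs ! 0 = 0 then Some (str_code s) else None)" by blast
  have "str_code p = 0 \<longleftrightarrow> p = []" for p by (cases p) auto
  then have "f [str_code p] = map_option str_code (if p = [] then Some s else None)" for p
    by (simp add: f(2))
  then have "partial_computable (\<lambda>p. if p = [] then Some s else None)"
    unfolding partial_computable_def using f(1) by blast
  then show ?thesis
    unfolding prefix_free_machine_def by (auto split: if_splits)
qed

lemma complexity_le: "U p = Some s \<Longrightarrow> prefix_complexity U s \<le> length p"
  unfolding prefix_complexity_def by (rule Least_le) blast

lemma complexity_le_machine:
  assumes "universal_prefix_free_machine U" "prefix_free_machine M"
  shows "\<exists>c. \<forall>p s. M p = Some s \<longrightarrow> prefix_complexity U s \<le> length p + c"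
proof -
  obtain c where c: "\<And>p s. M p = Some s \<Longrightarrow> \<exists>q. U q = Some s \<and> length q \<le> length p + c"
    using assms unfolding universal_prefix_free_machine_def by blast
  have "prefix_complexity U s \<le> length p + c" if "M p = Some s" for p s
    using c[OF that] complexity_le[of U] order_trans by blast
  then show ?thesis by blast
qed

lemma universal_range:
  assumes "universal_prefix_free_machine U" "prefix_free_machine M" "M p = Some s"
  shows "\<exists>q. U q = Some s"
  using assms unfolding universal_prefix_free_machine_def by blast

lemma complexity_attained:
  assumes "universal_prefix_free_machine U"
  shows "\<exists>p. U p = Some s \<and> length p = prefix_complexity U s"
proof -
  obtain q where "U q = Some s"
    using universal_range[OF assms prefix_free_constant[of s], of "[]" s] by auto
  then show ?thesis
    unfolding prefix_complexity_def
    by (intro LeastI_ex[of "\<lambda>n. \<exists>p. U p = Some s \<and> length p = n"]) blast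
qed

lemma card_complexity_le:
  assumes "universal_prefix_free_machine U"
  shows "finite {s. prefix_complexity U s \<le> k}" "card {s. prefix_complexity U s \<le> k} \<le> 2 ^ (k + 1)"
proof -
  let ?P = "{p :: bool list. set p \<subseteq> UNIV \<and> length p \<le> k}"
  have fin: "finite ?P" by (rule finite_lists_length_le) simp
  have sub: "{s. prefix_complexity U s \<le> k} \<subseteq> (\<lambda>p. the (U p)) ` ?P"
  proof
    fix s assume s: "s \<in> {s. prefix_complexity U s \<le> k}"
    obtain p where p: "U p = Some s" "length p = prefix_complexity U s"
      using complexity_attained[OF assms] by blast
    then have "s = the (U p)" "p \<in> ?P" using s by auto
    then show "s \<in> (\<lambda>p. the (U p)) ` ?P" by blast
  qed
  show "finite {s. prefix_complexity U s \<le> k}"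
    by (rule finite_subset[OF sub]) (use fin in simp)
  have "card {s. prefix_complexity U s \<le> k} \<le> card ?P"
    by (rule order_trans[OF card_mono[OF _ sub] card_image_le]) (use fin in auto)
  also have "card ?P = (\<Sum>i\<le>k. 2 ^ i)"
    by (subst card_lists_length_le) auto
  also have "\<dots> \<le> 2 ^ (k + 1)"
    by (induction k) auto
  finally show "card {s. prefix_complexity U s \<le> k} \<le> 2 ^ (k + 1)" .
qed

section \<open>Sequences that avoid sets of prefixes\<close>

text \<open>
  The prefixes of the sequences whose free bits sit at the positions in \<open>A\<close>.
\<close>
definition supported :: "nat set \<Rightarrow> nat \<Rightarrow> bool list set" where
  "supported A n = {w. length w = n \<and> (\<forall>i<n. w ! i \<longrightarrow> i \<in> A)}"

lemma finite_supported: "finite (supported A n)"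
  by (rule finite_subset[OF _ finite_lists_length_eq[of "UNIV :: bool set" n]])
     (auto simp: supported_def)

lemma take_supported: "w \<in> supported A N \<Longrightarrow> n \<le> N \<Longrightarrow> take n w \<in> supported A n"
  by (auto simp: supported_def)

lemma card_supported_ge: "2 ^ card (A \<inter> {..<n}) \<le> card (supported A n)"
proof -
  let ?f = "\<lambda>S. map (\<lambda>i. i \<in> S) [0..<n]"
  have "inj_on ?f (Pow (A \<inter> {..<n}))"
  proof (rule inj_onI)
    fix S T assume "S \<in> Pow (A \<inter> {..<n})" "T \<in> Pow (A \<inter> {..<n})" and eq: "?f S = ?f T"
    then have "S \<subseteq> {..<n}" "T \<subseteq> {..<n}" by auto
    then show "S = T" using eq by (auto simp: subset_iff)
  qed
  moreover have "?f ` Pow (A \<inter> {..<n}) \<subseteq> supported A n" by (auto simp: supported_def)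
  ultimately have "card (Pow (A \<inter> {..<n})) \<le> card (supported A n)"
    by (rule card_inj_on_le) (rule finite_supported)
  then show ?thesis by (simp add: card_Pow del: Pow_Int_eq)
qed

lemma card_supported_extensions_le:
  "card {w \<in> supported A N. take n w = v} \<le> 2 ^ card (A \<inter> {n..<N})"
proof -
  let ?f = "\<lambda>w. {i \<in> {n..<N}. w ! i}"
  have "inj_on ?f {w \<in> supported A N. take n w = v}"
  proof (rule inj_onI)
    fix w w' assume w: "w \<in> {w \<in> supported A N. take n w = v}" "w' \<in> {w \<in> supported A N. take n w = v}"
      and eq: "?f w = ?f w'"
    have "w ! i = w' ! i" if "i < N" for i
    proof (cases "i < n")
      case True
      have "take n w ! i = take n w' ! i" using w by simp
      then show ?thesis using True by simp
    next
      case False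
      then have "i \<in> ?f w \<longleftrightarrow> i \<in> ?f w'" using eq by blast
      then show ?thesis using False that by simp
    qed
    then show "w = w'" using w by (intro nth_equalityI) (auto simp: supported_def)
  qed
  moreover have "?f ` {w \<in> supported A N. take n w = v} \<subseteq> Pow (A \<inter> {n..<N})"
    by (auto simp: supported_def)
  ultimately have "card {w \<in> supported A N. take n w = v} \<le> card (Pow (A \<inter> {n..<N}))"
    by (rule card_inj_on_le) simp
  then show ?thesis by (simp add: card_Pow del: Pow_Int_eq)
qed

text \<open>
  A union bound: a summand is the probability that a uniformly random string from
  \<open>supported A N\<close> has its prefix of length \<open>n\<close> in \<open>B n\<close>.
\<close>
lemma exists_supported_avoiding:
  fixes B :: "nat \<Rightarrow> bool list set"
  assumes "(\<Sum>n\<in>{n0..N}. card (B n \<inter> supported A n) / 2 ^ card (A \<inter> {..<n})) < (1::real)"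
  shows "\<exists>w\<in>supported A N. \<forall>n\<in>{n0..N}. take n w \<notin> B n"
proof (rule ccontr)
  assume neg: "\<not> ?thesis"
  let ?E = "\<lambda>n v. {w \<in> supported A N. take n w = v}"
  let ?B = "\<lambda>n. B n \<inter> supported A n"
  have "supported A N \<subseteq> (\<Union>n\<in>{n0..N}. \<Union>v\<in>?B n. ?E n v)"
    using neg take_supported by fastforce
  then have "card (supported A N) \<le> card (\<Union>n\<in>{n0..N}. \<Union>v\<in>?B n. ?E n v)"
    by (rule card_mono[rotated]) (auto simp: finite_supported)
  also have "\<dots> \<le> (\<Sum>n\<in>{n0..N}. card (\<Union>v\<in>?B n. ?E n v))"
    by (rule card_UN_le) simp
  also have "\<dots> \<le> (\<Sum>n\<in>{n0..N}. \<Sum>v\<in>?B n. card (?E n v))"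
    by (intro sum_mono card_UN_le) (simp add: finite_supported)
  also have "\<dots> \<le> (\<Sum>n\<in>{n0..N}. \<Sum>v\<in>?B n. 2 ^ card (A \<inter> {n..<N}))"
    by (intro sum_mono card_supported_extensions_le)
  finally have "2 ^ card (A \<inter> {..<N}) \<le> (\<Sum>n\<in>{n0..N}. card (?B n) * 2 ^ card (A \<inter> {n..<N}))"
    using card_supported_ge[of A N] by simp
  then have "real (2 ^ card (A \<inter> {..<N})) \<le> real (\<Sum>n\<in>{n0..N}. card (?B n) * 2 ^ card (A \<inter> {n..<N}))"
    by (simp only: of_nat_le_iff)
  also have "\<dots> = (\<Sum>n\<in>{n0..N}. card (?B n) / 2 ^ card (A \<inter> {..<n})) * 2 ^ card (A \<inter> {..<N})"
    unfolding sum_distrib_right of_nat_sum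
  proof (rule sum.cong)
    fix n assume "n \<in> {n0..N}"
    then have "A \<inter> {..<N} = (A \<inter> {..<n}) \<union> (A \<inter> {n..<N})" by auto
    then have "card (A \<inter> {..<N}) = card (A \<inter> {..<n}) + card (A \<inter> {n..<N})"
      using card_Un_disjoint[of "A \<inter> {..<n}" "A \<inter> {n..<N}"] by fastforce
    then show "real (card (?B n) * 2 ^ card (A \<inter> {n..<N})) =
       card (?B n) / 2 ^ card (A \<inter> {..<n}) * 2 ^ card (A \<inter> {..<N})"
      by (simp add: power_add)
  qed simp
  also have "\<dots> < 1 * 2 ^ card (A \<inter> {..<N})"
    using assms by (intro mult_strict_right_mono) auto
  finally show False by (simp only: of_nat_power of_nat_numeral mult_1 less_irrefl)
qed

text \<open>
  Koenig's lemma for the binary tree \<open>P\<close>.  The path is built by keeping the invariant \<open>E w\<close> that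
  the current node has extensions in \<open>P\<close> of every length from its own on.
\<close>
lemma infinite_path:
  fixes P :: "bool list \<Rightarrow> bool"
  assumes closed: "\<And>w n. P w \<Longrightarrow> P (take n w)" and ex: "\<And>n. \<exists>w. length w = n \<and> P w"
  shows "\<exists>Y. \<forall>n. P (seq_prefix Y n)"
proof -
  define E where "E w \<longleftrightarrow> (\<forall>N\<ge>length w. \<exists>v. length v = N \<and> prefix w v \<and> P v)" for w
  have step: "\<exists>b. E (w @ [b])" if "E w" for w
  proof (rule ccontr)
    assume "\<nexists>b. E (w @ [b])"
    then have "\<exists>N\<ge>Suc (length w). \<forall>v. length v = N \<and> prefix (w @ [b]) v \<longrightarrow> \<not> P v" for b
      unfolding E_def by (metis length_append_singleton)
    then obtain f where f: "\<And>b. f b \<ge> Suc (length w)"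
      "\<And>b v. length v = f b \<Longrightarrow> prefix (w @ [b]) v \<Longrightarrow> \<not> P v" by metis
    let ?N = "max (f True) (f False)"
    have "length w \<le> ?N" using f(1)[of True] by simp
    then have "\<exists>v. length v = ?N \<and> prefix w v \<and> P v" using that by (simp only: E_def)
    then obtain v where v: "length v = ?N" "prefix w v" "P v" by blast
    then obtain u where u: "v = w @ u" by (auto simp: prefix_def)
    then obtain b u' where u': "u = b # u'" using v(1) f(1)[of True] by (cases u) auto
    obtain m where m: "f b = Suc (length w) + m" using f(1)[of b] le_Suc_ex by blast
    have "take (f b) v = (w @ [b]) @ take m u'" using u u' m by simp
    then have "prefix (w @ [b]) (take (f b) v)" by (rule prefixI)
    moreover have "f b \<le> ?N" by (cases b) auto
    ultimately show False using f(2)[of "take (f b) v" b] closed[OF v(3)] v(1) by simp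
  qed
  have "E []" using ex by (auto simp: E_def)
  then have "\<exists>f. \<forall>n. (length (f n) = n \<and> E (f n)) \<and> (\<exists>b. f (Suc n) = f n @ [b])"
  proof (intro dependent_nat_choice)
    show "\<exists>v. (length v = Suc n \<and> E v) \<and> (\<exists>b. v = w @ [b])" if w: "length w = n \<and> E w" for w n
    proof -
      obtain b where "E (w @ [b])" using step w by blast
      then show ?thesis using w by (intro exI[of _ "w @ [b]"]) simp
    qed
  qed auto
  then obtain f where f: "\<And>n. length (f n) = n" "\<And>n. E (f n)" "\<And>n. \<exists>b. f (Suc n) = f n @ [b]"
    by blast
  define Y where "Y n = f (Suc n) ! n" for n
  have "seq_prefix Y n = f n" for n
  proof (induction n)
    case (Suc n)
    obtain b where "f (Suc n) = f n @ [b]" using f(3) by blast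
    then show ?case using Suc f(1)[of n] by (simp add: seq_prefix_def Y_def nth_append)
  qed (use f(1)[of 0] in \<open>simp add: seq_prefix_def\<close>)
  moreover have "P (f n)" for n
  proof -
    obtain v where "length v = n" "prefix (f n) v" "P v" using f(1)[of n] f(2)[of n] unfolding E_def by auto
    then obtain zs where zs: "v = f n @ zs" by (auto elim: prefixE)
    then have "length v = length (f n) + length zs" by simp
    then have "zs = []" using \<open>length v = n\<close> f(1)[of n] by simp
    then have "v = f n" using zs by simp
    then show ?thesis using \<open>P v\<close> by simp
  qed
  ultimately show ?thesis by metis
qed

text \<open>
  The first Borel--Cantelli lemma without measures: the finite union bounds give finite
  strings of every length, and compactness turns them into an infinite sequence.
\<close>
lemma exists_sequence_avoiding:
  fixes B :: "nat \<Rightarrow> bool list set"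
  assumes "\<And>N. (\<Sum>n\<in>{n0..N}. card (B n \<inter> supported A n) / 2 ^ card (A \<inter> {..<n})) < (1::real)"
  shows "\<exists>Y. (\<forall>i. Y i \<longrightarrow> i \<in> A) \<and> (\<forall>n\<ge>n0. seq_prefix Y n \<notin> B n)"
proof -
  define P where "P w \<longleftrightarrow> w \<in> supported A (length w) \<and> (\<forall>n\<in>{n0..length w}. take n w \<notin> B n)" for w
  have "\<exists>Y. \<forall>n. P (seq_prefix Y n)"
  proof (rule infinite_path)
    show "P (take n w)" if "P w" for w n
      using that by (auto simp: P_def supported_def min_def)
    show "\<exists>w. length w = n \<and> P w" for n
      using exists_supported_avoiding[OF assms, of n] by (auto simp: P_def supported_def)
  qed
  then obtain Y where Y: "\<And>n. P (seq_prefix Y n)" by blast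
  have "i \<in> A" if "Y i" for i
    using Y[of "Suc i"] that by (auto simp: P_def supported_def seq_prefix_def nth_append)
  moreover have "seq_prefix Y n \<notin> B n" if "n \<ge> n0" for n
  proof -
    have "length (seq_prefix Y n) = n" by (simp add: seq_prefix_def)
    then show ?thesis using Y[of n] that unfolding P_def by force
  qed
  ultimately show ?thesis by blast
qed

section \<open>Few strings are compressible or close to a simple string\<close>

text \<open>
  A Chernoff bound: a set of at most \<open>m\<close> elements has weight at least one under
  \<open>3 ^ m * (1/3) ^ card T\<close>, and the sum of these weights over all subsets factorises.  The base \<open>3\<close>
  is the optimal choice for \<open>m = card S / 4\<close>.
\<close>
lemma card_small_subsets_le:
  assumes "finite S"
  shows "real (card {T. T \<subseteq> S \<and> card T \<le> m}) \<le> 3 ^ m * (4/3) ^ card S"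
proof -
  have fin: "finite {T. T \<subseteq> S \<and> card T \<le> m}"
    by (rule finite_subset[of _ "Pow S"]) (use assms in auto)
  have "real (card {T. T \<subseteq> S \<and> card T \<le> m}) = (\<Sum>T | T \<subseteq> S \<and> card T \<le> m. 1)" by simp
  also have "\<dots> \<le> (\<Sum>T | T \<subseteq> S \<and> card T \<le> m. 3 ^ m * (1/3) ^ card T)"
  proof (rule sum_mono)
    fix T assume "T \<in> {T. T \<subseteq> S \<and> card T \<le> m}"
    then have "(3::real) ^ card T \<le> 3 ^ m" by (intro power_increasing) auto
    then show "1 \<le> 3 ^ m * (1/3 :: real) ^ card T" by (simp add: power_divide)
  qed
  also have "\<dots> \<le> (\<Sum>T\<in>Pow S. 3 ^ m * (1/3) ^ card T)"
    by (rule sum_mono2) (use assms in auto)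
  also have "\<dots> = 3 ^ m * (\<Prod>x\<in>S. 1/3 + 1)"
    using prod_add[OF assms, of "\<lambda>_. 1/3 :: real" "\<lambda>_. 1"] by (simp add: sum_distrib_left)
  finally show ?thesis by simp
qed

definition mismatches :: "bool list \<Rightarrow> bool list \<Rightarrow> nat set" where
  "mismatches x y = {k. k < length x \<and> x ! k \<noteq> y ! k}"

text \<open>
  A string from \<open>supported A n\<close> is determined by its mismatches with \<open>x\<close> on \<open>A\<close>, because off \<open>A\<close>
  it vanishes.
\<close>
lemma card_supported_near_le:
  assumes x: "length x = n"
  shows "real (card {y \<in> supported A n. card (mismatches x y) \<le> m}) \<le> 3 ^ m * (4/3) ^ card (A \<inter> {..<n})"
proof -
  let ?D = "\<lambda>y. A \<inter> mismatches x y"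
  let ?S = "{T. T \<subseteq> A \<inter> {..<n} \<and> card T \<le> m}"
  let ?Y = "{y \<in> supported A n. card (mismatches x y) \<le> m}"
  have "inj_on ?D ?Y"
  proof (rule inj_onI)
    fix y z assume y: "y \<in> ?Y" and z: "z \<in> ?Y" and eq: "?D y = ?D z"
    have "y ! i = z ! i" if "i < n" for i
    proof (cases "i \<in> A")
      case True
      then have "x ! i \<noteq> y ! i \<longleftrightarrow> x ! i \<noteq> z ! i"
        using eq that x unfolding mismatches_def by blast
      then show ?thesis by auto
    next
      case False
      then show ?thesis using y z that by (auto simp: supported_def)
    qed
    then show "y = z" using y z by (intro nth_equalityI) (auto simp: supported_def)
  qed
  moreover have "?D ` ?Y \<subseteq> ?S"
  proof
    fix T assume "T \<in> ?D ` ?Y"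
    then obtain y where y: "y \<in> ?Y" "T = ?D y" by blast
    have "card T \<le> card (mismatches x y)"
      unfolding y(2) by (rule card_mono) (auto simp: mismatches_def)
    then show "T \<in> ?S" using y x by (auto simp: mismatches_def)
  qed
  moreover have "finite ?S" by (rule finite_subset[of _ "Pow (A \<inter> {..<n})"]) auto
  ultimately have "card ?Y \<le> card ?S" by (rule card_inj_on_le)
  then have "real (card ?Y) \<le> real (card ?S)" by simp
  also have "\<dots> \<le> 3 ^ m * (4/3) ^ card (A \<inter> {..<n})" by (rule card_small_subsets_le) simp
  finally show ?thesis .
qed

text \<open>
  With \<open>a\<close> free bits, this says that the complexity is at most \<open>a - 2 * log 2 n\<close>.  The logarithmic
  loss is negligible for the dimension, and it makes the probabilities summable.
\<close>
definition compressible :: "machine \<Rightarrow> nat \<Rightarrow> nat \<Rightarrow> bool list set" where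
  "compressible U a n = {y. n\<^sup>2 * 2 ^ prefix_complexity U y \<le> 2 ^ a}"

text \<open>
  The union of the Hamming balls of relative radius \<open>1/8\<close> around the strings of length \<open>n\<close> that
  have complexity at most \<open>n/16\<close>.
\<close>
definition near_simple :: "machine \<Rightarrow> nat \<Rightarrow> bool list set" where
  "near_simple U n = {y. \<exists>x. length x = n \<and> prefix_complexity U x \<le> n div 16 \<and>
     card (mismatches x y) \<le> n div 8}"

text \<open>
  All elements of the set have complexity at most the maximal value \<open>k\<close> that occurs, and this value
  itself satisfies \<open>n\<^sup>2 * 2 ^ k \<le> 2 ^ a\<close>.
\<close>
lemma card_compressible_le:
  assumes U: "universal_prefix_free_machine U" and n: "n > 0"
  shows "real (card (compressible U a n \<inter> supported A n)) \<le> 2 * 2 ^ a / n\<^sup>2"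
proof (cases "compressible U a n \<inter> supported A n = {}")
  case False
  let ?C = "compressible U a n \<inter> supported A n" and ?K = "prefix_complexity U"
  have fin: "finite ?C" by (simp add: finite_supported)
  define k where "k = Max (?K ` ?C)"
  obtain y where y: "y \<in> ?C" "k = ?K y"
    using Max_in[of "?K ` ?C"] fin False unfolding k_def by blast
  have "?C \<subseteq> {s. ?K s \<le> k}" using fin by (auto simp: k_def)
  then have "card ?C \<le> 2 ^ (k + 1)"
    by (rule order_trans[OF card_mono[OF card_complexity_le(1)[OF U]] card_complexity_le(2)[OF U]])
  then have "real (card ?C) \<le> real (2 ^ (k + 1))" by (simp only: of_nat_le_iff)
  moreover have "real (n\<^sup>2 * 2 ^ k) \<le> real (2 ^ a)"
    using y by (simp only: of_nat_le_iff) (simp add: compressible_def)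
  ultimately have "n\<^sup>2 * real (card ?C) \<le> n\<^sup>2 * (2 * 2 ^ k)" "n\<^sup>2 * (2 * 2 ^ k) \<le> (2 * 2 ^ a :: real)"
    by (auto intro!: mult_left_mono)
  then have "n\<^sup>2 * real (card ?C) \<le> 2 * 2 ^ a" by (rule order_trans)
  then show ?thesis using n by (simp add: pos_le_divide_eq mult.commute)
qed simp

lemma card_near_simple_le:
  assumes U: "universal_prefix_free_machine U"
  shows "real (card (near_simple U n \<inter> supported A n)) \<le>
    2 * 2 ^ (n div 16) * (3 ^ (n div 8) * (4/3) ^ card (A \<inter> {..<n}))"
proof -
  let ?X = "{x. length x = n \<and> prefix_complexity U x \<le> n div 16}"
  let ?Y = "\<lambda>x. {y \<in> supported A n. card (mismatches x y) \<le> n div 8}"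
  have X: "finite ?X" "card ?X \<le> 2 ^ (n div 16 + 1)"
  proof -
    have sub: "?X \<subseteq> {x. prefix_complexity U x \<le> n div 16}" by auto
    show "finite ?X" by (rule finite_subset[OF sub card_complexity_le(1)[OF U]])
    show "card ?X \<le> 2 ^ (n div 16 + 1)"
      by (rule order_trans[OF card_mono[OF card_complexity_le(1)[OF U] sub] card_complexity_le(2)[OF U]])
  qed
  have "near_simple U n \<inter> supported A n \<subseteq> (\<Union>x\<in>?X. ?Y x)" by (auto simp: near_simple_def)
  then have "card (near_simple U n \<inter> supported A n) \<le> card (\<Union>x\<in>?X. ?Y x)"
    by (rule card_mono[rotated]) (use X in \<open>auto simp: finite_supported\<close>)
  also have "\<dots> \<le> (\<Sum>x\<in>?X. card (?Y x))" by (rule card_UN_le[OF X(1)])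
  finally have "real (card (near_simple U n \<inter> supported A n)) \<le> real (\<Sum>x\<in>?X. card (?Y x))"
    by (simp only: of_nat_le_iff)
  also have "\<dots> = (\<Sum>x\<in>?X. real (card (?Y x)))" by simp
  also have "\<dots> \<le> (\<Sum>x\<in>?X. 3 ^ (n div 8) * (4/3) ^ card (A \<inter> {..<n}))"
    by (rule sum_mono, rule card_supported_near_le) simp
  also have "\<dots> = real (card ?X) * (3 ^ (n div 8) * (4/3) ^ card (A \<inter> {..<n}))" by simp
  also have "\<dots> \<le> real (2 ^ (n div 16 + 1)) * (3 ^ (n div 8) * (4/3) ^ card (A \<inter> {..<n}))"
    using X(2) by (intro mult_right_mono) (simp_all only: of_nat_le_iff, simp)
  finally show ?thesis by simp
qed

text \<open>
  With \<open>a\<close> replaced by its least value \<open>n/2\<close>, an increase of \<open>n\<close> by \<open>16\<close> multiplies the left-hand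
  side by \<open>2 * 3\<^sup>2 * (2/3) ^ 8 \<approx> 0.702\<close>, which is less than \<open>(49/50) ^ 16 \<approx> 0.724\<close>.  The constant \<open>9\<close> absorbs
  the rounding in the divisions.
\<close>
lemma near_simple_weight_le:
  assumes a: "n \<le> 2 * a"
  shows "2 * 2 ^ (n div 16) * (3 ^ (n div 8) * (4/3) ^ a) / 2 ^ a \<le> 9 * (49/50::real) ^ n"
proof -
  define j where "j = n div 16"
  have j: "n div 8 \<le> 2 * j + 1" "8 * j \<le> a" "n \<le> 16 * j + 15" 
    using a div_mult_mod_eq[of n 16] div_mult_mod_eq[of n 8] mod_less_divisor[of 16 n] unfolding j_def
    by linarith+
  have "2 * 2 ^ j * (3 ^ (n div 8) * (4/3) ^ a) / 2 ^ a = 2 * 2 ^ j * (3 ^ (n div 8) * (2/3::real) ^ a)"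
    using power_divide[of "4/3 :: real" 2 a] by simp
  also have "\<dots> \<le> 2 * 2 ^ j * (3 ^ (2 * j + 1) * (2/3) ^ (8 * j))"
    using j by (intro mult_left_mono mult_mono power_increasing power_decreasing) auto
  also have "\<dots> = 6 * (2 * 3\<^sup>2 * (2/3) ^ 8) ^ j"
    by (simp only: power_add power_mult power_mult_distrib power_one_right)
  also have "\<dots> \<le> 6 * ((49/50) ^ 16) ^ j"
    by (intro mult_left_mono power_mono) (simp_all add: power_divide)
  also have "\<dots> = 6 * (50/49) ^ 15 * (49/50) ^ (16 * j + 15)"
    by (simp add: power_add power_mult power_divide)
  also have "\<dots> \<le> 9 * (49/50) ^ n"
    using j(3) by (intro mult_mono power_decreasing) (simp_all add: power_divide)
  finally show ?thesis unfolding j_def .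
qed

text \<open>
  The probability of each of the two exceptional sets at length \<open>n\<close> is summable in \<open>n\<close>, so a large
  \<open>n0\<close> makes the total exceptional probability from \<open>n0\<close> on less than one.
\<close>
lemma exists_incompressible_isolated:
  assumes U: "universal_prefix_free_machine U" and A: "\<And>n. n \<le> 2 * card (A \<inter> {..<n})"
  shows "\<exists>n0 Y. (\<forall>i. Y i \<longrightarrow> i \<in> A) \<and> (\<forall>n\<ge>n0. seq_prefix Y n \<notin> compressible U (card (A \<inter> {..<n})) n \<and>
    seq_prefix Y n \<notin> near_simple U n)"
proof -
  let ?a = "\<lambda>n. card (A \<inter> {..<n})"
  let ?B = "\<lambda>n. compressible U (?a n) n \<union> near_simple U n"
  define w where "w n = 2 * (1 / real n ^ 2) + 9 * (49/50::real) ^ n" for n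
  have "summable w"
    unfolding w_def by (intro summable_add summable_mult summable_geometric)
      (use inverse_power_summable[of 2, where 'a=real] in \<open>auto simp: inverse_eq_divide\<close>)
  then obtain n0 where n0: "\<And>m n. m \<ge> n0 \<Longrightarrow> norm (sum w {m..<n}) < 1"
    unfolding summable_Cauchy by (meson zero_less_one)
  have le: "card (?B n \<inter> supported A n) / 2 ^ ?a n \<le> w n" if "n > 0" for n
  proof -
    have "real (card (?B n \<inter> supported A n)) \<le>
        real (card (compressible U (?a n) n \<inter> supported A n)) + real (card (near_simple U n \<inter> supported A n))"
      unfolding Int_Un_distrib2 of_nat_add[symmetric] of_nat_le_iff by (rule card_Un_le)
    also have "\<dots> \<le> 2 * 2 ^ ?a n / n\<^sup>2 + 2 * 2 ^ (n div 16) * (3 ^ (n div 8) * (4/3) ^ ?a n)"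
      using card_compressible_le[OF U that] by (intro add_mono card_near_simple_le U) simp
    finally have "card (?B n \<inter> supported A n) / 2 ^ ?a n \<le>
        (2 * 2 ^ ?a n / n\<^sup>2 + 2 * 2 ^ (n div 16) * (3 ^ (n div 8) * (4/3) ^ ?a n)) / 2 ^ ?a n"
      by (rule divide_right_mono) simp
    also have "\<dots> \<le> w n"
      unfolding w_def add_divide_distrib by (intro add_mono near_simple_weight_le[OF A]) simp
    finally show ?thesis .
  qed
  have "(\<Sum>n\<in>{Suc n0..N}. card (?B n \<inter> supported A n) / 2 ^ ?a n) < 1" for N
  proof -
    have "(\<Sum>n\<in>{Suc n0..N}. card (?B n \<inter> supported A n) / 2 ^ ?a n) \<le> (\<Sum>n\<in>{Suc n0..<Suc N}. w n)"
      unfolding atLeastLessThanSuc_atLeastAtMost by (intro sum_mono le) auto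
    also have "\<dots> < 1" using n0[of "Suc n0" "Suc N"] by simp
    finally show ?thesis .
  qed
  from exists_sequence_avoiding[OF this] show ?thesis by blast
qed

section \<open>Binary entropy\<close>

lemma binary_entropy_strict_mono_pos:
  assumes "0 < x" "x < y" "y \<le> 1/2"
  shows "binary_entropy x < binary_entropy y"
proof (rule DERIV_pos_imp_increasing_open[OF assms(2)])
  have D: "(binary_entropy has_real_derivative (ln (1 - z) - ln z) / ln 2) (at z)" if "0 < z" "z < 1" for z
  proof -
    have "binary_entropy = (\<lambda>z. - (z * ln z + (1 - z) * ln (1 - z)) / ln 2)"
      by (simp add: binary_entropy_def log_def fun_eq_iff diff_divide_distrib)
    moreover have "((\<lambda>z. - (z * ln z + (1 - z) * ln (1 - z)) / ln 2) has_real_derivative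
        (ln (1 - z) - ln z) / ln 2) (at z)"
      using that by (auto intro!: derivative_eq_intros)
    ultimately show ?thesis by simp
  qed
  show "\<exists>d. (binary_entropy has_real_derivative d) (at z) \<and> 0 < d" if "x < z" "z < y" for z
    using D[of z] that assms by (intro exI[of _ "(ln (1 - z) - ln z) / ln 2"]) auto
  show "continuous_on {x..y} binary_entropy"
    using D assms by (intro DERIV_continuous_on[where D = "\<lambda>z. (ln (1 - z) - ln z) / ln 2"])
      (auto intro: has_field_derivative_at_within)
qed

lemma binary_entropy_pos:
  assumes "0 < x" "x \<le> 1/2"
  shows "0 < binary_entropy x"
proof -
  have "x * log 2 x < 0" "(1 - x) * log 2 (1 - x) < 0"
    using assms by (auto intro!: mult_pos_neg)
  then show ?thesis by (simp add: binary_entropy_def)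
qed

lemma inj_on_binary_entropy: "inj_on binary_entropy {0..1/2}"
proof (rule linorder_inj_onI)
  fix x y :: real assume "x < y" "x \<in> {0..1/2}" "y \<in> {0..1/2}"
  then have "binary_entropy x < binary_entropy y"
    using binary_entropy_strict_mono_pos[of x y] binary_entropy_pos[of y]
    by (cases "x = 0") (auto simp: binary_entropy_def)
  then show "binary_entropy x \<noteq> binary_entropy y" by simp
qed auto

text \<open>
  The bounds \<open>H(1/16) \<le> 1/2 < H(1/8)\<close> reduce to \<open>(16/15) ^ 15 \<le> 2 ^ 4\<close> and \<open>2 < (8/7) ^ 7\<close>.
  The former only serves to start the intermediate value theorem away from \<open>0\<close>, where the
  continuity of \<open>H\<close> is less immediate.
\<close>
lemma binary_entropy_inv_half_less: "binary_entropy_inv (1/2) < 1/8"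
proof -
  have "log 2 (8/7) > 1/7"
  proof -
    have "log 2 2 < log 2 ((8/7::real) ^ 7)" by (subst log_less_cancel_iff) (auto simp: power_divide)
    also have "\<dots> = 7 * log 2 (8/7)" by (subst log_nat_power) auto
    finally show ?thesis by simp
  qed
  moreover have "log 2 (1/8) = -3" "log 2 (7/8) = - log 2 (8/7)"
  proof -
    show "log 2 (1/8) = -3" using log_pow_cancel[of 2 3] by (simp add: log_divide)
    show "log 2 (7/8) = - log 2 (8/7)" by (simp add: log_divide)
  qed
  ultimately have hi: "binary_entropy (1/8) > 1/2" by (simp add: binary_entropy_def)
  have "log 2 (16/15) \<le> 4/15"
  proof -
    have "log 2 ((16/15::real) ^ 15) \<le> log 2 (2 ^ 4)" by (subst log_le_cancel_iff) (auto simp: power_divide)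
    also have "\<dots> = 4" by (subst log_pow_cancel) auto
    finally have "15 * log 2 (16/15) \<le> 4" by (subst (asm) log_nat_power) auto
    then show ?thesis by simp
  qed
  moreover have "log 2 (1/16) = -4" "log 2 (15/16) = - log 2 (16/15)"
  proof -
    show "log 2 (1/16) = -4" using log_pow_cancel[of 2 4] by (simp add: log_divide)
    show "log 2 (15/16) = - log 2 (16/15)" by (simp add: log_divide)
  qed
  ultimately have lo: "binary_entropy (1/16) \<le> 1/2" by (simp add: binary_entropy_def)
  have "continuous_on {1/16..1/8} binary_entropy"
    unfolding binary_entropy_def [abs_def] by (intro continuous_intros) auto
  then obtain p where p: "1/16 \<le> p" "p \<le> 1/8" "binary_entropy p = 1/2"
    using IVT'[of binary_entropy "1/16" "1/2" "1/8"] lo hi by auto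
  then have "binary_entropy_inv (1/2) = p"
    unfolding binary_entropy_inv_def by (intro the_inv_into_f_eq inj_on_binary_entropy) auto
  then show ?thesis using p hi by (cases "p = 1/8") auto
qed

section \<open>The dimension of zero-padded sequences\<close>

lemma card_evens: "card ({i. even i} \<inter> {..<n}) = (n + 1) div 2"
proof (induction n)
  case (Suc n)
  have "{i. even i} \<inter> {..<Suc n} =
    (if even n then insert n ({i. even i} \<inter> {..<n}) else {i. even i} \<inter> {..<n})"
    by (auto simp: less_Suc_eq)
  then show ?case using Suc by auto
qed simp

lemma seq_prefix_pad:
  assumes "\<forall>i. Y i \<longrightarrow> even i"
  shows "seq_prefix Y (2 * m) = pad (map (\<lambda>i. Y (2 * i)) [0..<m])"
proof (induction m)
  case (Suc m)
  have "\<not> Y (Suc (2 * m))" using assms by auto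
  then show ?case using Suc by (simp add: seq_prefix_def pad_def)
qed (simp add: seq_prefix_def pad_def)

text \<open>
  It suffices to describe the prefixes of the lengths \<open>2 * (k + 1)\<^sup>2\<close>, since the dimension is a
  lower limit.
\<close>
lemma effective_dim_le_half:
  assumes U: "universal_prefix_free_machine U" and Y: "\<forall>i. Y i \<longrightarrow> even i"
  shows "effective_dim U Y \<le> ereal (1/2)"
proof -
  let ?K = "\<lambda>n. real (prefix_complexity U (seq_prefix Y n))"
  obtain c where c: "\<And>p s. pad_machine p = Some s \<Longrightarrow> prefix_complexity U s \<le> length p + c"
    using complexity_le_machine[OF U prefix_free_pad_machine] by blast
  define r where "r k = 2 * (Suc k * Suc k)" for k
  have "strict_mono r" unfolding strict_mono_Suc_iff by (simp add: r_def)
  have K: "prefix_complexity U (seq_prefix Y (r k)) \<le> Suc k * Suc k + Suc k + 1 + c" for k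
  proof -
    let ?q = "map (\<lambda>i. Y (2 * i)) [0..<Suc k * Suc k]"
    have "pad_machine (replicate (Suc k) True @ False # ?q) = Some (seq_prefix Y (r k))"
      unfolding r_def seq_prefix_pad[OF Y] by (rule pad_machine_program) (simp only: length_map length_upt diff_zero)
    from c[OF this] show ?thesis by simp
  qed
  have "liminf (\<lambda>n. ereal (?K n / n)) \<le> liminf ((\<lambda>n. ereal (?K n / n)) \<circ> r)"
    by (rule liminf_subseq_mono) fact
  also have "\<dots> \<le> liminf (\<lambda>k. ereal (1/2 + inverse (Suc k) / 2 + inverse (Suc k) * inverse (Suc k) * (1 + c) / 2))"
  proof (intro Liminf_mono always_eventually allI)
    fix k
    have "?K (r k) \<le> real (Suc k * Suc k + Suc k + 1 + c)" using K of_nat_le_iff by blast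
    then have "?K (r k) / r k \<le> real (Suc k * Suc k + Suc k + 1 + c) / r k"
      by (rule divide_right_mono) simp
    also have "\<dots> = (real (Suc k) * real (Suc k) + real (Suc k) + 1 + c) / (2 * (real (Suc k) * real (Suc k)))"
      by (simp only: r_def of_nat_add of_nat_mult of_nat_1 of_nat_numeral)
    also have "\<dots> = 1/2 + inverse (Suc k) / 2 + inverse (Suc k) * inverse (Suc k) * (1 + c) / 2"
    proof -
      have "(x * x + x + 1 + c) / (2 * (x * x)) = 1/2 + inverse x / 2 + inverse x * inverse x * (1 + c) / 2"
        if "x > 0" for x :: real using that by (simp add: field_simps)
      then show ?thesis by (simp only: of_nat_0_less_iff zero_less_Suc)
    qed
    finally show "((\<lambda>n. ereal (?K n / n)) \<circ> r) k \<le>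
        ereal (1/2 + inverse (Suc k) / 2 + inverse (Suc k) * inverse (Suc k) * (1 + c) / 2)" by simp
  qed
  also have "\<dots> = ereal (1/2)"
  proof (rule lim_imp_Liminf)
    have "(\<lambda>k. 1/2 + inverse (Suc k) / 2 + inverse (Suc k) * inverse (Suc k) * (1 + c) / 2)
        \<longlonglongrightarrow> 1/2 + 0 / 2 + 0 * 0 * (1 + real c) / 2"
      by (intro tendsto_intros LIMSEQ_inverse_real_of_nat) simp_all
    then show "(\<lambda>k. ereal (1/2 + inverse (Suc k) / 2 + inverse (Suc k) * inverse (Suc k) * (1 + c) / 2))
        \<longlonglongrightarrow> ereal (1/2)" by simp
  qed simp
  finally show ?thesis unfolding effective_dim_def .
qed

lemma effective_dim_ge_half:
  assumes "\<And>n. n \<ge> n0 \<Longrightarrow> seq_prefix Y n \<notin> compressible U (a n) n" and a: "\<And>n. n \<le> 2 * a n"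
  shows "ereal (1/2) \<le> effective_dim U Y"
proof -
  let ?K = "\<lambda>n. real (prefix_complexity U (seq_prefix Y n))"
  have "ereal (1/2) = liminf (\<lambda>n. ereal (1/2 - 2 * (log 2 n / n)))"
  proof (rule lim_imp_Liminf[symmetric])
    have "(\<lambda>n. 1/2 - 2 * (log 2 n / n)) \<longlonglongrightarrow> 1/2 - 2 * 0"
      by (intro tendsto_intros)
    then show "(\<lambda>n. ereal (1/2 - 2 * (log 2 n / n))) \<longlonglongrightarrow> ereal (1/2)" by simp
  qed simp
  also have "\<dots> \<le> effective_dim U Y"
    unfolding effective_dim_def
  proof (rule Liminf_mono, rule eventually_sequentiallyI[of "Suc n0"])
    fix n assume n: "Suc n0 \<le> n"
    have "2 ^ a n < n\<^sup>2 * 2 ^ prefix_complexity U (seq_prefix Y n)"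
      using assms(1)[of n] n by (simp add: compressible_def)
    then have "real (2 ^ a n) < real (n\<^sup>2 * 2 ^ prefix_complexity U (seq_prefix Y n))"
      by (simp only: of_nat_less_iff)
    then have "log 2 (2 ^ a n) < log 2 (real n ^ 2 * 2 ^ prefix_complexity U (seq_prefix Y n))"
      using n by (subst log_less_cancel_iff) auto
    also have "\<dots> = 2 * log 2 n + ?K n"
      using n by (simp add: log_mult log_nat_power)
    finally have "real (a n) < 2 * log 2 n + ?K n" by (simp add: log_nat_power)
    moreover have "real n \<le> 2 * real (a n)" using a[of n] by linarith
    ultimately have "real n / 2 - 2 * log 2 n \<le> ?K n" by linarith
    then have "(real n / 2 - 2 * log 2 n) / n \<le> ?K n / n" by (rule divide_right_mono) simp
    then show "ereal (1/2 - 2 * (log 2 n / n)) \<le> ereal (?K n / n)"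
      using n by (simp add: diff_divide_distrib)
  qed
  finally show ?thesis .
qed

lemma effective_dim_pos_of_near:
  assumes Y: "\<And>n. n \<ge> n0 \<Longrightarrow> seq_prefix Y n \<notin> near_simple U n"
    and X: "seq_dist X Y < ereal (1/8)"
  shows "effective_dim U X > 0"
proof -
  let ?K = "\<lambda>n. real (prefix_complexity U (seq_prefix X n))"
  have "eventually (\<lambda>n. ereal (hamming_dist (seq_prefix X n) (seq_prefix Y n)) < ereal (1/8)) sequentially"
    using X unfolding seq_dist_def by (rule Limsup_lessD)
  then have "eventually (\<lambda>n. ereal (1/16) \<le> ereal (?K n / n)) sequentially"
    using eventually_ge_at_top[of "Suc n0"]
  proof eventually_elim
    fix n assume d: "ereal (hamming_dist (seq_prefix X n) (seq_prefix Y n)) < ereal (1/8)" and n: "Suc n0 \<le> n"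
    have len: "length (seq_prefix X n) = n" by (simp add: seq_prefix_def)
    have "card (mismatches (seq_prefix X n) (seq_prefix Y n)) / n < 1/8"
      using d by (simp add: hamming_dist_def mismatches_def len)
    then have "card (mismatches (seq_prefix X n) (seq_prefix Y n)) \<le> n div 8"
      using n by (simp add: field_simps)
    then have "\<not> prefix_complexity U (seq_prefix X n) \<le> n div 16"
      using Y[of n] n len unfolding near_simple_def by fastforce
    then have "n \<le> 16 * prefix_complexity U (seq_prefix X n)" by linarith
    then have "real n \<le> 16 * ?K n" by linarith
    then show "ereal (1/16) \<le> ereal (?K n / n)" using n by (simp add: field_simps)
  qed
  then have "ereal (1/16) \<le> effective_dim U X"
    unfolding effective_dim_def by (rule Liminf_bounded)
  then show ?thesis by (rule less_le_trans[rotated]) simp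
qed

theorem proposition3p4:
  fixes U :: machine
  assumes "universal_prefix_free_machine U"
  shows "\<exists>Y :: nat \<Rightarrow> bool. effective_dim U Y = ereal (1 / 2) \<and>
    (\<forall>X :: nat \<Rightarrow> bool.
       seq_dist X Y \<le> ereal (binary_entropy_inv (1 / 2)) \<longrightarrow> effective_dim U X > 0)"
proof -
  have evens: "n \<le> 2 * card ({i. even i} \<inter> {..<n})" for n
    unfolding card_evens by linarith
  obtain n0 Y where Y: "\<forall>i. Y i \<longrightarrow> even i"
    "\<And>n. n \<ge> n0 \<Longrightarrow> seq_prefix Y n \<notin> compressible U (card ({i. even i} \<inter> {..<n})) n"
    "\<And>n. n \<ge> n0 \<Longrightarrow> seq_prefix Y n \<notin> near_simple U n"
    using exists_incompressible_isolated[OF assms evens] by auto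
  have "effective_dim U Y = ereal (1/2)"
    by (rule antisym[OF effective_dim_le_half[OF assms Y(1)] effective_dim_ge_half[OF Y(2) evens]])
  moreover have "effective_dim U X > 0" if "seq_dist X Y \<le> ereal (binary_entropy_inv (1/2))" for X
    using effective_dim_pos_of_near[OF Y(3)] that binary_entropy_inv_half_less
    by (meson ereal_less_eq(3) le_less_trans less_ereal.simps(1))
  ultimately show ?thesis by blast
qed

end
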